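(* Let $F$ be a field of characteristic $\neq 2$ and let $r\ge 0$, $s>0$ be integers. Then the following bracket relations hold: 1) $[\mathfrak{K}_{r,s},\mathfrak{K}_{r,s}]\subset\mathfrak{K}_{r,s}$; 2) $[\mathfrak{K}_{r,s},\mathfrak{P}_{r,s}]\subset\mathfrak{P}_{r,s}$; 3) $[\mathfrak{P}_{r,s},\mathfrak{P}_{r,s}]\subset\mathfrak{K}_{r,s}$.
   Context: Let $n=r+s$, let $e_1,\dots,e_n$ be the canonical basis of $F^n$, and let $Q$ be the symmetric bilinear form on $F^n$ with $Q(e_i,e_j)=0$ for $i\ne j$, $Q(e_i,e_i)=1$ for $1\le i\le r$, $Q(e_i,e_i)=-1$ for $r+1\le i\le r+s$. $C\ell(r,s)$ is the Clifford algebra over $F$ of $(F^n,Q)$, with sign convention $v\cdot v=-Q(v,v)1$; it is a Lie algebra with $[x,y]=xy-yx$. Let $c$ be the unique algebra anti-automorphism of $C\ell(r,s)$ with $c(v)=-v$ for $v\in F^n$, and let $\mathfrak{G}_{r,s}=\{\varphi\in C\ell(r,s):c(\varphi)=-\varphi\}$. Let $\beta$ be the algebra automorphism of $C\ell(r,s)$ with $\beta(e_i)=e_i$ for $1\le i\le r$ and $\beta(e_{r+j})=-e_{r+j}$ for $1\le j\le s$; it leaves $\mathfrak{G}_{r,s}$ invariant. $\mathfrak{K}_{r,s}$ and $\mathfrak{P}_{r,s}$ are the $+1$ and $-1$ eigenspaces of $\beta$ restricted to $\mathfrak{G}_{r,s}$. *)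

theory Defs
  imports
    "Jordan_Normal_Form.Matrix"
    "HOL-Algebra.QuotRing"
    "HOL-Library.FuncSet"
    "HOL-Library.Poly_Mapping"
begin

section \<open>The free associative algebra on a set\<close>

text \<open>Words over an alphabet form the free monoid, written additively because the
  convolution product on \<^typ>\<open>'k \<Rightarrow>\<^sub>0 'a\<close> expects an additive monoid of exponents.\<close>

datatype 'x word = Word (letters: "'x list")

instantiation word :: (type) monoid_add
begin
definition zero_word :: "'a word" where "0 = Word []"
definition plus_word :: "'a word \<Rightarrow> 'a word \<Rightarrow> 'a word"
  where "u + w = Word (letters u @ letters w)"
instance
  by standard (auto simp: zero_word_def plus_word_def)
end

text \<open>The free algebra over the field \<^typ>\<open>'a\<close> on a set \<open>X\<close> of generators; the scalar \<open>a\<close>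
  sits in it as \<open>single 0 a\<close>.\<close>

definition free_algebra :: "'x set \<Rightarrow> ('x word \<Rightarrow>\<^sub>0 'a::field) ring" where
  "free_algebra X =
    \<lparr>carrier = {p. \<forall>w\<in>Poly_Mapping.keys p. set (letters w) \<subseteq> X},
     mult = (*), one = 1, zero = 0, add = (+)\<rparr>"

definition gen :: "'x \<Rightarrow> ('x word \<Rightarrow>\<^sub>0 'a::field)" where
  "gen x = Poly_Mapping.single (Word [x]) 1"

section \<open>The Clifford algebra of signature (r, s)\<close>

text \<open>Vectors of \<^typ>\<open>'a vec\<close> are indexed from 0, so \<open>e\<^sub>1, \<dots>, e\<^sub>n\<close> are
  \<open>unit_vec n 0, \<dots>, unit_vec n (n - 1)\<close>.\<close>

definition Qform :: "nat \<Rightarrow> nat \<Rightarrow> 'a::field vec \<Rightarrow> 'a vec \<Rightarrow> 'a" where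
  "Qform r s u v = (\<Sum>i<r. u $ i * v $ i) - (\<Sum>i=r..<r+s. u $ i * v $ i)"

text \<open>The first two families of relations turn the free algebra on the underlying set of \<open>F\<^sup>n\<close>
  into the tensor algebra of the vector space \<open>F\<^sup>n\<close>; the third one is \<open>v \<cdot> v = - Q(v,v) 1\<close>.\<close>

definition clifford_relations :: "nat \<Rightarrow> nat \<Rightarrow> ('a::field vec word \<Rightarrow>\<^sub>0 'a) set" where
  "clifford_relations r s =
     {gen (u + v) - gen u - gen v |u v. u \<in> carrier_vec (r + s) \<and> v \<in> carrier_vec (r + s)}
   \<union> {gen (a \<cdot>\<^sub>v v) - Poly_Mapping.single 0 a * gen v |a v. v \<in> carrier_vec (r + s)}
   \<union> {gen v * gen v + Poly_Mapping.single 0 (Qform r s v v) |v. v \<in> carrier_vec (r + s)}"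

definition clifford_ideal :: "nat \<Rightarrow> nat \<Rightarrow> ('a::field vec word \<Rightarrow>\<^sub>0 'a) set" where
  "clifford_ideal r s = Idl\<^bsub>free_algebra (carrier_vec (r + s))\<^esub> (clifford_relations r s)"

type_synonym 'a clifford = "('a vec word \<Rightarrow>\<^sub>0 'a) set"

definition clifford_class :: "nat \<Rightarrow> nat \<Rightarrow> ('a::field vec word \<Rightarrow>\<^sub>0 'a) \<Rightarrow> 'a clifford" where
  "clifford_class r s p = clifford_ideal r s +>\<^bsub>free_algebra (carrier_vec (r + s))\<^esub> p"

definition Cl :: "nat \<Rightarrow> nat \<Rightarrow> ('a::field, 'a clifford) module" where
  "Cl r s = ring.extend (free_algebra (carrier_vec (r + s)) Quot clifford_ideal r s)
     (module.fields (\<lambda>a x. clifford_class r s (Poly_Mapping.single 0 a)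
        \<otimes>\<^bsub>free_algebra (carrier_vec (r + s)) Quot clifford_ideal r s\<^esub> x))"

text \<open>The canonical map \<open>F\<^sup>n \<rightarrow> C\<ell>(r,s)\<close>, by which vectors are regarded as elements of the
  Clifford algebra.\<close>

definition vect :: "nat \<Rightarrow> nat \<Rightarrow> 'a::field vec \<Rightarrow> 'a clifford" where
  "vect r s v = clifford_class r s (gen v)"

section \<open>Algebra automorphisms and anti-automorphisms\<close>

text \<open>An anti-automorphism of \<open>A\<close> is an isomorphism from \<open>A\<close> to its opposite algebra. Maps are
  taken to be \<^const>\<open>extensional\<close> so that they are determined by their values on the carrier.\<close>

definition algebra_iso ::
  "('f, 'b) module \<Rightarrow> ('f, 'c) module \<Rightarrow> ('b \<Rightarrow> 'c) set" where
  "algebra_iso A B =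
    {h \<in> ring_iso A B. \<forall>a. \<forall>x\<in>carrier A. h (a \<odot>\<^bsub>A\<^esub> x) = a \<odot>\<^bsub>B\<^esub> h x}"

definition opposite :: "('f, 'b) module \<Rightarrow> ('f, 'b) module" where
  "opposite A = A\<lparr>mult := \<lambda>x y. y \<otimes>\<^bsub>A\<^esub> x\<rparr>"

definition is_c :: "nat \<Rightarrow> nat \<Rightarrow> ('a::field clifford \<Rightarrow> 'a clifford) \<Rightarrow> bool" where
  "is_c r s h \<longleftrightarrow>
     h \<in> algebra_iso (Cl r s) (opposite (Cl r s)) \<and> h \<in> extensional (carrier (Cl r s)) \<and>
     (\<forall>v\<in>carrier_vec (r + s). h (vect r s v) = \<ominus>\<^bsub>Cl r s\<^esub> vect r s v)"

definition is_beta :: "nat \<Rightarrow> nat \<Rightarrow> ('a::field clifford \<Rightarrow> 'a clifford) \<Rightarrow> bool" where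
  "is_beta r s h \<longleftrightarrow>
     h \<in> algebra_iso (Cl r s) (Cl r s) \<and> h \<in> extensional (carrier (Cl r s)) \<and>
     (\<forall>i<r. h (vect r s (unit_vec (r + s) i)) = vect r s (unit_vec (r + s) i)) \<and>
     (\<forall>j<s. h (vect r s (unit_vec (r + s) (r + j)))
        = \<ominus>\<^bsub>Cl r s\<^esub> vect r s (unit_vec (r + s) (r + j)))"

text \<open>Existence and uniqueness are \<open>ex1_is_c\<close> and \<open>ex1_is_beta\<close> below.\<close>

definition c_map :: "nat \<Rightarrow> nat \<Rightarrow> 'a::field clifford \<Rightarrow> 'a clifford" where
  "c_map r s = (THE h. is_c r s h)"

definition beta_map :: "nat \<Rightarrow> nat \<Rightarrow> 'a::field clifford \<Rightarrow> 'a clifford" where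
  "beta_map r s = (THE h. is_beta r s h)"

section \<open>The Lie algebra and its eigenspaces\<close>

definition \<GG> :: "nat \<Rightarrow> nat \<Rightarrow> 'a::field clifford set" where
  "\<GG> r s = {\<phi> \<in> carrier (Cl r s). c_map r s \<phi> = \<ominus>\<^bsub>Cl r s\<^esub> \<phi>}"

definition \<KK> :: "nat \<Rightarrow> nat \<Rightarrow> 'a::field clifford set" where
  "\<KK> r s = {\<phi> \<in> \<GG> r s. beta_map r s \<phi> = \<phi>}"

definition \<PP> :: "nat \<Rightarrow> nat \<Rightarrow> 'a::field clifford set" where
  "\<PP> r s = {\<phi> \<in> \<GG> r s. beta_map r s \<phi> = \<ominus>\<^bsub>Cl r s\<^esub> \<phi>}"

definition scalars :: "'a::field ring" where
  "scalars = \<lparr>carrier = UNIV, mult = (*), one = 1, zero = 0, add = (+)\<rparr>"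

text \<open>As usual for Lie algebras, the bracket of two subspaces is the linear span of the
  brackets \<open>[x,y] = xy - yx\<close> of their elements.\<close>

definition lie_bracket :: "nat \<Rightarrow> nat \<Rightarrow> 'a::field clifford \<Rightarrow> 'a clifford \<Rightarrow> 'a clifford" where
  "lie_bracket r s x y = x \<otimes>\<^bsub>Cl r s\<^esub> y \<ominus>\<^bsub>Cl r s\<^esub> y \<otimes>\<^bsub>Cl r s\<^esub> x"

definition bracket_space ::
  "nat \<Rightarrow> nat \<Rightarrow> 'a::field clifford set \<Rightarrow> 'a clifford set \<Rightarrow> 'a clifford set" where
  "bracket_space r s U V =
    \<Inter>{W. submodule W scalars (Cl r s) \<and> (\<forall>x\<in>U. \<forall>y\<in>V. lie_bracket r s x y \<in> W)}"

section \<open>The maps \<open>c_map\<close> and \<open>beta_map\<close> are well defined\<close>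


lemma pm_induct [case_names zero single add]:
  fixes p :: "'k \<Rightarrow>\<^sub>0 'b::comm_monoid_add"
  assumes "P 0"
    and "\<And>k b. k \<in> Poly_Mapping.keys p \<Longrightarrow> P (Poly_Mapping.single k b)"
    and "\<And>f g. P f \<Longrightarrow> P g \<Longrightarrow> P (f + g)"
  shows "P p"
proof -
  have "Poly_Mapping.keys f \<subseteq> Poly_Mapping.keys p \<Longrightarrow> P f" for f
  proof (induction f rule: Poly_Mapping.update_induct)
    case const show ?case by fact
  next
    case (update f a b)
    have eq: "Poly_Mapping.update a b f = Poly_Mapping.single a b + f"
      using update(1) by (intro poly_mapping_eqI)
        (auto simp: lookup_update lookup_add lookup_single in_keys_iff)
    from update have "Poly_Mapping.keys f \<subseteq> Poly_Mapping.keys p" "a \<in> Poly_Mapping.keys p"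
      by (auto simp: keys_update)
    then show ?case unfolding eq using assms update by blast
  qed
  then show ?thesis by blast
qed

lemma keys_uminus': "Poly_Mapping.keys (- (p :: 'k \<Rightarrow>\<^sub>0 'b::ab_group_add)) = Poly_Mapping.keys p"
  by (auto simp: in_keys_iff)

lemma ring_free_algebra:
  fixes X :: "'a set"
  shows "ring (free_algebra X :: ('a word \<Rightarrow>\<^sub>0 'b::field) ring)"
proof (rule ringI)
  show "abelian_group (free_algebra X :: ('a word \<Rightarrow>\<^sub>0 'b) ring)"
  proof (rule abelian_groupI)
    fix x assume x: "x \<in> carrier (free_algebra X :: ('a word \<Rightarrow>\<^sub>0 'b) ring)"
    have "-x \<in> carrier (free_algebra X)" "-x \<oplus>\<^bsub>free_algebra X\<^esub> x = \<zero>\<^bsub>free_algebra X\<^esub>"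
      using x by (auto simp: free_algebra_def keys_uminus')
    then show "\<exists>y\<in>carrier (free_algebra X). y \<oplus>\<^bsub>free_algebra X\<^esub> x = \<zero>\<^bsub>free_algebra X\<^esub>" by blast
  next
    fix x y assume "x \<in> carrier (free_algebra X :: ('a word \<Rightarrow>\<^sub>0 'b) ring)" "y \<in> carrier (free_algebra X :: ('a word \<Rightarrow>\<^sub>0 'b) ring)"
    then show "x \<oplus>\<^bsub>free_algebra X\<^esub> y \<in> carrier (free_algebra X)"
      using Poly_Mapping.keys_add[of x y] by (fastforce simp: free_algebra_def)
  qed (auto simp: free_algebra_def algebra_simps)
  show "Group.monoid (free_algebra X :: ('a word \<Rightarrow>\<^sub>0 'b) ring)"
  proof (rule monoidI)
    fix x y assume "x \<in> carrier (free_algebra X :: ('a word \<Rightarrow>\<^sub>0 'b) ring)" "y \<in> carrier (free_algebra X :: ('a word \<Rightarrow>\<^sub>0 'b) ring)"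
    then show "x \<otimes>\<^bsub>free_algebra X\<^esub> y \<in> carrier (free_algebra X)"
      using keys_mult[of x y] by (fastforce simp: free_algebra_def plus_word_def)
  qed (auto simp: free_algebra_def algebra_simps zero_word_def)
qed (auto simp: free_algebra_def algebra_simps)

context
  fixes r s :: nat
begin

private abbreviation "V \<equiv> (carrier_vec (r + s) :: 'a::field vec set)"
private abbreviation "T \<equiv> (free_algebra V :: ('a::field vec word \<Rightarrow>\<^sub>0 'a) ring)"
private abbreviation "C \<equiv> (Cl r s :: ('a::field, 'a clifford) module)"
private abbreviation "I \<equiv> (clifford_ideal r s :: ('a::field vec word \<Rightarrow>\<^sub>0 'a) set)"
private abbreviation "cls \<equiv> (clifford_class r s :: ('a::field vec word \<Rightarrow>\<^sub>0 'a) \<Rightarrow> 'a clifford)"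
private abbreviation "sc \<equiv> (\<lambda>a. Poly_Mapping.single 0 a :: 'a::field vec word \<Rightarrow>\<^sub>0 'a)"

lemma T_simps: "mult T = (*)" "one T = 1" "zero T = 0" "add T = (+)"
  by (auto simp: free_algebra_def)

lemma carr_T: "p \<in> carrier T \<longleftrightarrow> (\<forall>w\<in>Poly_Mapping.keys p. set (letters w) \<subseteq> V)"
  by (auto simp: free_algebra_def)

interpretation T: ring T by (rule ring_free_algebra)

lemma T_uminus: "p \<in> carrier T \<Longrightarrow> \<ominus>\<^bsub>T\<^esub> p = - p"
  by (rule T.minus_equality) (auto simp: T_simps carr_T keys_uminus')

lemma gen_carr: "v \<in> V \<Longrightarrow> gen v \<in> carrier T"
  by (auto simp: carr_T gen_def)

lemma sc_carr: "sc a \<in> carrier T"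
  by (auto simp: carr_T zero_word_def)

lemma one_carr: "1 \<in> carrier T"
  using T.one_closed by (simp add: T_simps)

lemma T_closed: "p \<in> carrier T \<Longrightarrow> q \<in> carrier T \<Longrightarrow> p + q \<in> carrier T"
  "p \<in> carrier T \<Longrightarrow> q \<in> carrier T \<Longrightarrow> p * q \<in> carrier T"
  "p \<in> carrier T \<Longrightarrow> - p \<in> carrier T"
  "p \<in> carrier T \<Longrightarrow> q \<in> carrier T \<Longrightarrow> p - q \<in> carrier T"
  using T.add.m_closed[of p q] T.m_closed[of p q] T.a_inv_closed[of p] T.minus_closed[of p q]
  by (auto simp: T_simps T_uminus a_minus_def)

lemma rel_carr: "clifford_relations r s \<subseteq> carrier T"
  unfolding clifford_relations_def
  by (auto intro!: T_closed gen_carr sc_carr)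

interpretation I: ideal I T
  unfolding clifford_ideal_def by (rule T.genideal_ideal[OF rel_carr])

lemma rel_in_I: "clifford_relations r s \<subseteq> I"
  unfolding clifford_ideal_def by (rule T.genideal_self[OF rel_carr])

lemma C_simps: "carrier C = carrier (T Quot I)" "mult C = mult (T Quot I)"
  "one C = one (T Quot I)" "zero C = zero (T Quot I)" "add C = add (T Quot I)"
  "smult C = (\<lambda>a x. cls (sc a) \<otimes>\<^bsub>T Quot I\<^esub> x)"
  by (simp_all add: Cl_def ring.defs module.defs)

lemma ring_C: "ring C"
proof -
  interpret q: ring "T Quot I" by (rule I.quotient_is_ring)
  show ?thesis
  proof (rule ringI)
    show "abelian_group C"
      by (rule abelian_groupI) (auto simp: C_simps q.a_ac intro!: bexI[of _ "\<ominus>\<^bsub>T Quot I\<^esub> _"] q.l_neg)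
    show "Group.monoid C"
      by (rule monoidI) (auto simp: C_simps q.m_assoc)
  qed (auto simp: C_simps q.l_distr q.r_distr)
qed

interpretation C: ring C by (rule ring_C)

lemma cls_hom: "cls \<in> ring_hom T C"
  using I.rcos_ring_hom by (auto simp: ring_hom_def C_simps clifford_class_def[abs_def])

lemma cls_closed: "p \<in> carrier T \<Longrightarrow> cls p \<in> carrier C"
  by (rule ring_hom_closed[OF cls_hom])

lemma cls_mult: "p \<in> carrier T \<Longrightarrow> q \<in> carrier T \<Longrightarrow> cls (p * q) = cls p \<otimes>\<^bsub>C\<^esub> cls q"
  using ring_hom_mult[OF cls_hom, of p q] by (simp add: T_simps)

lemma cls_add: "p \<in> carrier T \<Longrightarrow> q \<in> carrier T \<Longrightarrow> cls (p + q) = cls p \<oplus>\<^bsub>C\<^esub> cls q"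
  using ring_hom_add[OF cls_hom, of p q] by (simp add: T_simps)

lemma cls_one: "cls 1 = \<one>\<^bsub>C\<^esub>"
  using ring_hom_one[OF cls_hom] by (simp add: T_simps)

lemma cls_zero: "cls 0 = \<zero>\<^bsub>C\<^esub>"
  using ring_hom_zero[OF cls_hom T.ring_axioms C.ring_axioms] by (simp add: T_simps)

lemma cls_uminus: "p \<in> carrier T \<Longrightarrow> cls (- p) = \<ominus>\<^bsub>C\<^esub> cls p"
  by (rule C.minus_equality[symmetric]) (simp_all add: cls_add[symmetric] T_closed cls_zero cls_closed)

lemma smult_cls: "p \<in> carrier T \<Longrightarrow> a \<odot>\<^bsub>C\<^esub> cls p = cls (sc a * p)"
  by (simp add: cls_mult sc_carr) (simp add: C_simps)

lemma carr_C: "x \<in> carrier C \<longleftrightarrow> (\<exists>p\<in>carrier T. x = cls p)"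
  by (auto simp: C_simps FactRing_def A_RCOSETS_def RCOSETS_def clifford_class_def a_r_coset_def)

lemma cls_eqI: "p \<in> carrier T \<Longrightarrow> q \<in> carrier T \<Longrightarrow> p - q \<in> I \<Longrightarrow> cls p = cls q"
  unfolding clifford_class_def
  using T.quotient_eq_iff_same_a_r_cos[OF I.is_ideal, of p q] by (simp add: a_minus_def T_uminus T_simps)

lemma vect_add: "u \<in> V \<Longrightarrow> v \<in> V \<Longrightarrow> vect r s (u + v) = vect r s u \<oplus>\<^bsub>C\<^esub> vect r s v"
proof -
  assume uv: "u \<in> V" "v \<in> V"
  have "gen (u + v) - (gen u + gen v) \<in> I"
    using uv rel_in_I by (auto simp: clifford_relations_def diff_diff_eq[symmetric])
  then show ?thesis unfolding vect_def using uv
    by (simp add: cls_add[symmetric] gen_carr cls_eqI T_closed)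
qed

lemma vect_smult: "v \<in> V \<Longrightarrow> vect r s (a \<cdot>\<^sub>v v) = a \<odot>\<^bsub>C\<^esub> vect r s v"
proof -
  assume v: "v \<in> V"
  have "gen (a \<cdot>\<^sub>v v) - sc a * gen v \<in> I"
    using v rel_in_I by (auto simp: clifford_relations_def)
  then show ?thesis unfolding vect_def using v
    by (simp add: smult_cls gen_carr cls_eqI T_closed sc_carr)
qed

lemma vect_sq: "v \<in> V \<Longrightarrow> vect r s v \<otimes>\<^bsub>C\<^esub> vect r s v = \<ominus>\<^bsub>C\<^esub> (Qform r s v v \<odot>\<^bsub>C\<^esub> \<one>\<^bsub>C\<^esub>)"
proof -
  assume v: "v \<in> V"
  have "gen v * gen v - - sc (Qform r s v v) \<in> I"
    using v rel_in_I by (auto simp: clifford_relations_def)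
  then have "cls (gen v * gen v) = cls (- sc (Qform r s v v))"
    by (intro cls_eqI) (auto intro!: T_closed gen_carr sc_carr v)
  then show ?thesis unfolding vect_def using v
    by (simp add: cls_mult gen_carr cls_uminus sc_carr cls_one[symmetric] smult_cls one_carr)
qed

lemma vect_closed: "v \<in> V \<Longrightarrow> vect r s v \<in> carrier C"
  by (simp add: vect_def cls_closed gen_carr)

lemma vect_uminus: "v \<in> V \<Longrightarrow> vect r s (- v) = \<ominus>\<^bsub>C\<^esub> vect r s v"
proof -
  assume v: "v \<in> V"
  have "- v = (-1) \<cdot>\<^sub>v v" by (rule eq_vecI) auto
  then have "vect r s (- v) = (-1) \<odot>\<^bsub>C\<^esub> vect r s v" using v by (simp add: vect_smult)
  also have "\<dots> = cls (- gen v)"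
    unfolding vect_def using v by (simp add: smult_cls gen_carr single_uminus)
  finally show ?thesis using v by (simp add: cls_uminus gen_carr vect_def)
qed

lemma hom_unique:
  assumes h: "h \<in> algebra_iso C B" "h' \<in> algebra_iso C B"
    and eq: "\<And>v. v \<in> V \<Longrightarrow> h (vect r s v) = h' (vect r s v)"
    and x: "x \<in> carrier C"
  shows "h x = h' x"
proof -
  have hh: "h \<in> ring_hom C B" "h' \<in> ring_hom C B"
    using h by (auto simp: algebra_iso_def ring_iso_def)
  obtain p where p: "p \<in> carrier T" "x = cls p" using carr_C[THEN iffD1, OF x] by blast
  have one: "set vs \<subseteq> V \<Longrightarrow> h (cls (Poly_Mapping.single (Word vs) a)) = h' (cls (Poly_Mapping.single (Word vs) a))"
    for vs and a :: 'a
  proof (induction vs arbitrary: a)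
    case Nil
    have "cls (Poly_Mapping.single (Word []) a) = a \<odot>\<^bsub>C\<^esub> \<one>\<^bsub>C\<^esub>"
      by (simp add: cls_one[symmetric] smult_cls one_carr zero_word_def)
    then show ?case using h hh by (simp add: algebra_iso_def ring_hom_one)
  next
    case (Cons v vs)
    have c: "Poly_Mapping.single (Word vs) a \<in> carrier T" "v \<in> V" using Cons by (auto simp: carr_T)
    have "Poly_Mapping.single (Word (v # vs)) a = gen v * Poly_Mapping.single (Word vs) a"
      by (simp add: gen_def mult_single plus_word_def)
    then have "cls (Poly_Mapping.single (Word (v # vs)) a) = vect r s v \<otimes>\<^bsub>C\<^esub> cls (Poly_Mapping.single (Word vs) a)"
      using c by (simp add: cls_mult gen_carr vect_def)
    then show ?case using c Cons eq ring_hom_mult[OF hh(1)] ring_hom_mult[OF hh(2)]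
      by (simp add: vect_closed cls_closed)
  qed
  have "p \<in> carrier T \<and> h (cls p) = h' (cls p)"
  proof (induction p rule: pm_induct)
    case zero
    have "cls (0 :: 'a vec word \<Rightarrow>\<^sub>0 'a) = cls (Poly_Mapping.single (Word []) 0)" by simp
    then show ?case using one[of "[]" 0] by (auto simp: carr_T)
  next
    case (single k b)
    then have "set (letters k) \<subseteq> V" using p by (auto simp: carr_T)
    then show ?case using one[of "letters k" b] by (auto simp: carr_T)
  next
    case (add f g)
    then show ?case using ring_hom_add[OF hh(1)] ring_hom_add[OF hh(2)]
      by (simp add: T_closed cls_add cls_closed)
  qed
  then show ?thesis using p by simp
qed

text \<open>Both maps are induced by a map of words: \<open>v \<mapsto> - v\<close> on letters with reversal for
  \<open>c_map\<close>, and the change of sign of the last \<open>s\<close> coordinates without reversal for \<open>beta_map\<close>.\<close>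

definition word_map :: "bool \<Rightarrow> ('b \<Rightarrow> 'b) \<Rightarrow> 'b word \<Rightarrow> 'b word" where
  "word_map b f w = Word ((if b then rev else id) (map f (letters w)))"

context
  fixes b :: bool and f :: "'a::field vec \<Rightarrow> 'a vec"
  assumes f_inv: "\<And>v. f (f v) = v"
    and f_carr: "\<And>v. v \<in> V \<Longrightarrow> f v \<in> V"
    and f_add: "\<And>u v. u \<in> V \<Longrightarrow> v \<in> V \<Longrightarrow> f (u + v) = f u + f v"
    and f_smult: "\<And>a v. v \<in> V \<Longrightarrow> f (a \<cdot>\<^sub>v v) = a \<cdot>\<^sub>v f v"
    and f_Q: "\<And>v. v \<in> V \<Longrightarrow> Qform r s (f v) (f v) = Qform r s v v"
begin

private abbreviation "wm \<equiv> word_map b f"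
private abbreviation "\<Phi> \<equiv> (Poly_Mapping.map_key wm :: ('a vec word \<Rightarrow>\<^sub>0 'a) \<Rightarrow> _)"
private abbreviation "D \<equiv> (if b then opposite C else C)"

lemma wm_wm: "wm (wm w) = w"
  by (cases w) (auto simp: word_map_def rev_map[symmetric] f_inv comp_def)

lemma wm_inj: "inj wm"
  by (rule inj_on_inverseI[of _ wm]) (simp add: wm_wm)

lemma wm_plus: "wm (v + w) = (if b then wm w + wm v else wm v + wm w)"
  by (simp add: word_map_def plus_word_def)

lemma \<Phi>_single: "\<Phi> (Poly_Mapping.single w a) = Poly_Mapping.single (wm w) a"
  using map_key_single[OF wm_inj, of "wm w" a] by (simp add: wm_wm)

lemma \<Phi>_add: "\<Phi> (p + q) = \<Phi> p + \<Phi> q"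
  by (rule map_key_plus[OF wm_inj])

lemma \<Phi>_zero: "\<Phi> 0 = 0"
  by (rule map_key_zero[OF wm_inj])

lemma \<Phi>_uminus: "\<Phi> (- p) = - \<Phi> p"
  by (rule minus_unique[symmetric]) (simp add: \<Phi>_add[symmetric] \<Phi>_zero)

lemma \<Phi>_diff: "\<Phi> (p - q) = \<Phi> p - \<Phi> q"
  using \<Phi>_add[of p "- q"] by (simp add: \<Phi>_uminus)

lemma \<Phi>_\<Phi>: "\<Phi> (\<Phi> p) = p"
  by (simp add: map_key_compose[OF wm_inj wm_inj] comp_def wm_wm map_key_id)

lemma \<Phi>_mult: "\<Phi> (p * q) = (if b then \<Phi> q * \<Phi> p else \<Phi> p * \<Phi> q)"
proof (induction p rule: pm_induct)
  case (single k c)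
  show ?case
  proof (induction q rule: pm_induct)
    case (single l d)
    show ?case unfolding mult_single \<Phi>_single wm_plus by (simp add: mult.commute)
  next
    case (add g h)
    then show ?case unfolding distrib_left \<Phi>_add by (auto simp: algebra_simps)
  qed (simp only: \<Phi>_zero mult_zero_left mult_zero_right if_cancel)
next
  case (add g h)
  then show ?case unfolding distrib_right \<Phi>_add by (auto simp: algebra_simps)
qed (simp only: \<Phi>_zero mult_zero_left mult_zero_right if_cancel)

lemma \<Phi>_sc: "\<Phi> (sc a) = sc a"
  by (simp add: \<Phi>_single) (simp add: word_map_def zero_word_def)

lemma \<Phi>_one: "\<Phi> 1 = 1"
  using \<Phi>_sc[of 1] by simp

lemma \<Phi>_gen: "\<Phi> (gen v) = gen (f v)"
  by (simp add: gen_def \<Phi>_single) (simp add: word_map_def)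

lemma \<Phi>_carr: "p \<in> carrier T \<Longrightarrow> \<Phi> p \<in> carrier T"
proof -
  assume p: "p \<in> carrier T"
  have "set (letters w) \<subseteq> V" if "wm w \<in> Poly_Mapping.keys p" for w
  proof -
    have "set (letters (wm w)) \<subseteq> V" using p that by (auto simp: carr_T)
    then have "f ` set (letters w) \<subseteq> V" by (auto simp: word_map_def split: if_splits)
    then show ?thesis using f_carr f_inv by (metis image_subset_iff subsetI)
  qed
  then show ?thesis by (auto simp: carr_T keys_map_key[OF wm_inj])
qed

lemma sc_comm: "sc a * p = p * sc a"
proof (induction p rule: pm_induct)
  case (single k c)
  show ?case by (simp add: mult_single mult.commute)
qed (auto simp: algebra_simps)

lemma \<Phi>_rel: "p \<in> clifford_relations r s \<Longrightarrow> \<Phi> p \<in> clifford_relations r s"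
proof -
  assume "p \<in> clifford_relations r s"
  then consider (1) u v where "u \<in> V" "v \<in> V" "p = gen (u + v) - gen u - gen v"
    | (2) a v where "v \<in> V" "p = gen (a \<cdot>\<^sub>v v) - sc a * gen v"
    | (3) v where "v \<in> V" "p = gen v * gen v + sc (Qform r s v v)"
    unfolding clifford_relations_def by auto
  then show ?thesis
  proof cases
    case 1
    then have "\<Phi> p = gen (f u + f v) - gen (f u) - gen (f v)"
      by (simp add: \<Phi>_diff \<Phi>_gen f_add)
    then show ?thesis using 1 f_carr unfolding clifford_relations_def by blast
  next
    case 2
    then have "\<Phi> p = gen (a \<cdot>\<^sub>v f v) - sc a * gen (f v)"
      unfolding 2(2) \<Phi>_diff \<Phi>_mult \<Phi>_sc \<Phi>_gen f_smult[OF 2(1)] by (simp add: sc_comm)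
    then show ?thesis using 2 f_carr unfolding clifford_relations_def by blast
  next
    case 3
    then have "\<Phi> p = gen (f v) * gen (f v) + sc (Qform r s (f v) (f v))"
      by (simp add: \<Phi>_add \<Phi>_gen f_Q \<Phi>_mult \<Phi>_sc)
    then show ?thesis using 3 f_carr unfolding clifford_relations_def by blast
  qed
qed

lemma \<Phi>_I: "p \<in> I \<Longrightarrow> \<Phi> p \<in> I"
proof -
  assume p: "p \<in> I"
  define J where "J = {p \<in> carrier T. \<Phi> p \<in> I}"
  have JI: "p \<in> J \<longleftrightarrow> p \<in> carrier T \<and> \<Phi> p \<in> I" for p
    by (simp add: J_def)
  have "ideal J T"
  proof (rule idealI[OF T.ring_axioms])
    show "subgroup J (add_monoid T)"
    proof (rule group.subgroupI[OF T.a_group])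
      show "J \<subseteq> carrier (add_monoid T)" by (simp add: J_def)
      have "0 \<in> I" "0 \<in> carrier T" using I.zero_closed T.zero_closed by (simp_all only: T_simps)
      then have "0 \<in> J" unfolding JI \<Phi>_zero by blast
      then show "J \<noteq> {}" by blast
    next
      fix x :: "'a vec word \<Rightarrow>\<^sub>0 'a" assume "x \<in> J"
      then have x: "x \<in> carrier T" "\<Phi> x \<in> I" by (simp_all only: JI)
      have "- \<Phi> x \<in> I" using I.a_inv_closed[OF x(2)] unfolding T_uminus[OF \<Phi>_carr[OF x(1)]] .
      moreover have "inv\<^bsub>add_monoid T\<^esub> x = - x" using T_uminus[OF x(1)] unfolding a_inv_def .
      ultimately show "inv\<^bsub>add_monoid T\<^esub> x \<in> J"
        using T_closed(3)[OF x(1)] by (simp only: JI \<Phi>_uminus)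
    next
      fix x y :: "'a vec word \<Rightarrow>\<^sub>0 'a" assume "x \<in> J" "y \<in> J"
      then have xy: "x \<in> carrier T" "\<Phi> x \<in> I" "y \<in> carrier T" "\<Phi> y \<in> I" by (simp_all only: JI)
      have "x + y \<in> J" unfolding JI \<Phi>_add
        using T_closed(1)[OF xy(1,3)] I.a_closed[OF xy(2,4)] unfolding T_simps by blast
      then show "x \<otimes>\<^bsub>add_monoid T\<^esub> y \<in> J" by (simp add: T_simps)
    qed
  next
    fix x y :: "'a vec word \<Rightarrow>\<^sub>0 'a" assume "x \<in> J" "y \<in> carrier T"
    then have xy: "x \<in> carrier T" "\<Phi> x \<in> I" "y \<in> carrier T" by (simp_all only: JI)
    have *: "\<Phi> x * \<Phi> y \<in> I" "\<Phi> y * \<Phi> x \<in> I"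
      using I.I_r_closed[OF xy(2) \<Phi>_carr[OF xy(3)]] I.I_l_closed[OF xy(2) \<Phi>_carr[OF xy(3)]]
      unfolding T_simps by blast+
    show "y \<otimes>\<^bsub>T\<^esub> x \<in> J" "x \<otimes>\<^bsub>T\<^esub> y \<in> J"
      unfolding T_simps JI \<Phi>_mult using * T_closed(2)[OF xy(1,3)] T_closed(2)[OF xy(3,1)] by presburger+
  qed
  moreover have "clifford_relations r s \<subseteq> J"
  proof
    fix p :: "'a vec word \<Rightarrow>\<^sub>0 'a" assume "p \<in> clifford_relations r s"
    then show "p \<in> J" unfolding JI using rel_carr rel_in_I \<Phi>_rel by blast
  qed
  ultimately have "I \<subseteq> J"
    unfolding clifford_ideal_def by (rule T.genideal_minimal)
  then show ?thesis using p JI by blast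
qed

lemma \<Phi>_cls: "p \<in> carrier T \<Longrightarrow> \<Phi> ` cls p = cls (\<Phi> p)"
proof -
  have cls_eq: "cls q = (\<lambda>x. x + q) ` I" for q
    unfolding clifford_class_def a_r_coset_def r_coset_def by (auto simp: T_simps)
  have sub: "\<Phi> ` cls q \<subseteq> cls (\<Phi> q)" for q
  proof
    fix y assume "y \<in> \<Phi> ` cls q"
    then obtain x where x: "x \<in> I" "y = \<Phi> (x + q)" unfolding cls_eq by blast
    then show "y \<in> cls (\<Phi> q)" unfolding cls_eq \<Phi>_add by (blast intro: \<Phi>_I)
  qed
  have "cls (\<Phi> p) \<subseteq> \<Phi> ` cls p"
  proof
    fix y assume "y \<in> cls (\<Phi> p)"
    then have "\<Phi> y \<in> \<Phi> ` cls (\<Phi> p)" by (rule imageI)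
    then have "\<Phi> y \<in> cls p" using sub[of "\<Phi> p"] unfolding \<Phi>_\<Phi> by (rule rev_subsetD)
    then have "\<Phi> (\<Phi> y) \<in> \<Phi> ` cls p" by (rule imageI)
    then show "y \<in> \<Phi> ` cls p" unfolding \<Phi>_\<Phi> .
  qed
  then show ?thesis using sub[of p] by (rule equalityI[rotated])
qed

lemma ex_iso:
  "\<exists>h. h \<in> algebra_iso C D \<and> h \<in> extensional (carrier C) \<and> (\<forall>v\<in>V. h (vect r s v) = vect r s (f v))"
proof (intro exI conjI ballI)
  define H where "H = restrict (\<lambda>x. \<Phi> ` x) (carrier C)"
  have h: "H (cls p) = cls (\<Phi> p)" if "p \<in> carrier T" for p
    using that by (simp add: H_def cls_closed \<Phi>_cls)
  show "H \<in> extensional (carrier C)" by (simp add: H_def)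
  have D: "carrier D = carrier C" "one D = one C" "zero D = zero C" "add D = add C" "smult D = smult C"
    "mult D = (if b then \<lambda>x y. y \<otimes>\<^bsub>C\<^esub> x else mult C)"
    by (auto simp: opposite_def)
  have hc: "H x \<in> carrier C" "H (H x) = x" if x: "x \<in> carrier C" for x
  proof -
    obtain p where p: "p \<in> carrier T" "x = cls p" using carr_C[THEN iffD1, OF x] by blast
    show "H x \<in> carrier C" unfolding p(2) h[OF p(1)] using p by (intro cls_closed \<Phi>_carr)
    show "H (H x) = x" unfolding p(2) h[OF p(1)] h[OF \<Phi>_carr[OF p(1)]] \<Phi>_\<Phi> ..
  qed
  have "H \<in> ring_hom C D"
  proof (rule ring_hom_memI)
    fix x y :: "'a clifford" assume "x \<in> carrier C" "y \<in> carrier C"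
    then obtain p q where pq: "p \<in> carrier T" "x = cls p" "q \<in> carrier T" "y = cls q"
      using carr_C[THEN iffD1] by metis
    have "H (cls p \<otimes>\<^bsub>C\<^esub> cls q) = H (cls (p * q))" using pq by (simp add: cls_mult)
    also have "\<dots> = cls (\<Phi> (p * q))" using pq by (intro h T_closed)
    also have "\<dots> = H (cls p) \<otimes>\<^bsub>D\<^esub> H (cls q)"
      unfolding h[OF pq(1)] h[OF pq(3)] using \<Phi>_carr[OF pq(1)] \<Phi>_carr[OF pq(3)]
      by (auto simp: D cls_mult \<Phi>_mult)
    finally show "H (x \<otimes>\<^bsub>C\<^esub> y) = H x \<otimes>\<^bsub>D\<^esub> H y" using pq by simp
    have "H (cls p \<oplus>\<^bsub>C\<^esub> cls q) = H (cls (p + q))" using pq by (simp add: cls_add)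
    also have "\<dots> = cls (\<Phi> (p + q))" using pq by (intro h T_closed)
    also have "\<dots> = H (cls p) \<oplus>\<^bsub>D\<^esub> H (cls q)"
      unfolding h[OF pq(1)] h[OF pq(3)] using pq by (simp add: D cls_add \<Phi>_add \<Phi>_carr)
    finally show "H (x \<oplus>\<^bsub>C\<^esub> y) = H x \<oplus>\<^bsub>D\<^esub> H y" using pq by simp
  next
    show "H \<one>\<^bsub>C\<^esub> = \<one>\<^bsub>D\<^esub>" unfolding cls_one[symmetric] h[OF one_carr] by (simp add: \<Phi>_one D cls_one)
    show "H x \<in> carrier D" if "x \<in> carrier C" for x unfolding D using that by (rule hc)
  qed
  moreover have "bij_betw H (carrier C) (carrier D)"
    unfolding D
    by (rule bij_betwI[where g = H]) (use hc in blast)+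
  moreover have "H (a \<odot>\<^bsub>C\<^esub> x) = a \<odot>\<^bsub>D\<^esub> H x" if x: "x \<in> carrier C" for a :: 'a and x
  proof -
    obtain p where p: "p \<in> carrier T" "x = cls p" using carr_C[THEN iffD1, OF x] by blast
    have "H (a \<odot>\<^bsub>C\<^esub> cls p) = H (cls (sc a * p))" using p by (simp add: smult_cls)
    also have "\<dots> = cls (\<Phi> (sc a * p))" using p by (intro h T_closed sc_carr)
    also have "\<dots> = a \<odot>\<^bsub>D\<^esub> H (cls p)"
      unfolding h[OF p(1)] D \<Phi>_mult \<Phi>_sc smult_cls[OF \<Phi>_carr[OF p(1)]] by (simp add: sc_comm)
    finally show ?thesis using p by simp
  qed
  ultimately show "H \<in> algebra_iso C D" unfolding algebra_iso_def ring_iso_def by blast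
  show "H (vect r s v) = vect r s (f v)" if "v \<in> V" for v
    unfolding vect_def h[OF gen_carr[OF that]] by (simp add: \<Phi>_gen)
qed

end

theorem ex1_is_c: "\<exists>!h. is_c r s (h :: 'a::field clifford \<Rightarrow> 'a clifford)"
proof -
  have "\<exists>h. h \<in> algebra_iso C (if True then opposite C else C) \<and> h \<in> extensional (carrier C) \<and>
    (\<forall>v\<in>V. h (vect r s v) = vect r s (- v :: 'a vec))"
  proof (rule ex_iso)
    fix u v :: "'a vec" and a :: 'a assume v: "v \<in> V"
    show "- (a \<cdot>\<^sub>v v) = a \<cdot>\<^sub>v - v" by (rule eq_vecI) auto
    show "Qform r s (- v) (- v) = Qform r s v v"
      using v unfolding Qform_def by (simp cong: sum.cong_simp)
    show "- (u + v) = - u + - v" if "u \<in> V"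
      using v that by (intro eq_vecI) auto
  qed (auto intro: eq_vecI)
  then obtain h where "h \<in> algebra_iso C (opposite C)" "h \<in> extensional (carrier C)"
    "\<forall>v\<in>V. h (vect r s v) = vect r s (- v :: 'a vec)" by auto
  then have "is_c r s h" by (simp add: is_c_def vect_uminus)
  moreover have "h' = h''" if "is_c r s h'" "is_c r s h''" for h' h'' :: "'a clifford \<Rightarrow> 'a clifford"
  proof (rule extensionalityI)
    show "h' \<in> extensional (carrier C)" "h'' \<in> extensional (carrier C)"
      using that by (simp_all add: is_c_def)
    show "h' x = h'' x" if "x \<in> carrier C" for x
      by (rule hom_unique[OF _ _ _ that, where B = "opposite C"])
        (use \<open>is_c r s h'\<close> \<open>is_c r s h''\<close> in \<open>simp_all add: is_c_def\<close>)
  qed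
  ultimately show ?thesis by blast
qed

definition flip_vec :: "'a::field vec \<Rightarrow> 'a vec" where
  "flip_vec v = vec (dim_vec v) (\<lambda>i. if i < r then v $ i else - v $ i)"

theorem ex1_is_beta: "\<exists>!h. is_beta r s (h :: 'a::field clifford \<Rightarrow> 'a clifford)"
proof -
  have "\<exists>h. h \<in> algebra_iso C (if False then opposite C else C) \<and> h \<in> extensional (carrier C) \<and>
    (\<forall>v\<in>V. h (vect r s v) = vect r s (flip_vec v :: 'a vec))"
  proof (rule ex_iso)
    fix u v :: "'a vec" and a :: 'a assume v: "v \<in> V"
    show "flip_vec (a \<cdot>\<^sub>v v) = a \<cdot>\<^sub>v flip_vec v" by (rule eq_vecI) (auto simp: flip_vec_def)
    show "Qform r s (flip_vec v) (flip_vec v) = Qform r s v v"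
      using v unfolding Qform_def flip_vec_def by (simp cong: sum.cong_simp)
    show "flip_vec (u + v) = flip_vec u + flip_vec v" if "u \<in> V"
      using v that by (intro eq_vecI) (auto simp: flip_vec_def)
    show "flip_vec v \<in> V" unfolding flip_vec_def by (rule carrier_vecI) (use v in simp)
  next
    show "flip_vec (flip_vec v) = v" for v :: "'a vec"
      by (rule eq_vecI) (auto simp: flip_vec_def)
  qed
  then obtain h where h: "h \<in> algebra_iso C C" "h \<in> extensional (carrier C)"
    "\<forall>v\<in>V. h (vect r s v) = vect r s (flip_vec v :: 'a vec)" by auto
  have "flip_vec (unit_vec (r + s) i :: 'a vec) = unit_vec (r + s) i" if "i < r" for i
    using that by (intro eq_vecI) (auto simp: flip_vec_def)
  moreover have "flip_vec (unit_vec (r + s) (r + j) :: 'a vec) = - unit_vec (r + s) (r + j)" if "j < s" for j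
    using that by (intro eq_vecI) (auto simp: flip_vec_def)
  ultimately have "is_beta r s h"
    using h by (simp add: is_beta_def vect_uminus)
  moreover have "h' = h''" if hh: "is_beta r s h'" "is_beta r s h''" for h' h'' :: "'a clifford \<Rightarrow> 'a clifford"
  proof -
    have iso: "h' \<in> algebra_iso C C" "h'' \<in> algebra_iso C C" using hh by (auto simp: is_beta_def)
    then have rh: "h' \<in> ring_hom C C" "h'' \<in> ring_hom C C" by (auto simp: algebra_iso_def ring_iso_def)
    have unit: "h' (vect r s (unit_vec (r + s) k)) = h'' (vect r s (unit_vec (r + s) k))" if k: "k < r + s" for k
    proof (cases "k < r")
      case True
      then show ?thesis using hh by (simp add: is_beta_def)
    next
      case False
      then have "k = r + (k - r)" "k - r < s" using k by auto
      then obtain j where "k = r + j" "j < s" by blast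
      then show ?thesis using hh by (simp add: is_beta_def)
    qed
    have smult: "h' (vect r s (a \<cdot>\<^sub>v v)) = h'' (vect r s (a \<cdot>\<^sub>v v))"
      if v: "v \<in> V" "h' (vect r s v) = h'' (vect r s v)" for a and v :: "'a vec"
    proof -
      have "h' (a \<odot>\<^bsub>C\<^esub> vect r s v) = a \<odot>\<^bsub>C\<^esub> h' (vect r s v)"
        "h'' (a \<odot>\<^bsub>C\<^esub> vect r s v) = a \<odot>\<^bsub>C\<^esub> h'' (vect r s v)"
        using iso vect_closed[OF v(1)] unfolding algebra_iso_def by blast+
      then show ?thesis using v(2) by (simp only: vect_smult[OF v(1)])
    qed
    have "h' (vect r s v) = h'' (vect r s v)" if v: "v \<in> V" for v
    proof -
      have "h' (vect r s (vec (r + s) (\<lambda>i. if i < k then v $ i else 0)))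
          = h'' (vect r s (vec (r + s) (\<lambda>i. if i < k then v $ i else 0)))" if "k \<le> r + s" for k
        using that
      proof (induction k)
        case 0
        have "vec (r + s) (\<lambda>i. if i < 0 then v $ i else 0) = 0\<^sub>v (r + s)" by (intro eq_vecI) auto
        moreover have "vect r s (0\<^sub>v (r + s) :: 'a vec) = \<zero>\<^bsub>C\<^esub>"
        proof -
          have "vect r s (0\<^sub>v (r + s) :: 'a vec) = vect r s (0 \<cdot>\<^sub>v 0\<^sub>v (r + s))"
            by (rule arg_cong[of _ _ "vect r s"]) auto
          also have "\<dots> = 0 \<odot>\<^bsub>C\<^esub> vect r s (0\<^sub>v (r + s))" by (rule vect_smult) simp
          also have "\<dots> = \<zero>\<^bsub>C\<^esub>"
            unfolding vect_def by (simp add: smult_cls gen_carr cls_zero)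
          finally show ?thesis .
        qed
        ultimately show ?case
          using ring_hom_zero[OF rh(1) C.ring_axioms C.ring_axioms] ring_hom_zero[OF rh(2) C.ring_axioms C.ring_axioms]
          by simp
      next
        case (Suc k)
        let ?w = "vec (r + s) (\<lambda>i. if i < k then v $ i else 0)"
        have eq: "vec (r + s) (\<lambda>i. if i < Suc k then v $ i else 0) = ?w + v $ k \<cdot>\<^sub>v unit_vec (r + s) k"
          using Suc by (intro eq_vecI) (auto simp: less_Suc_eq)
        show ?case unfolding eq
          using Suc smult[of "unit_vec (r + s) k" "v $ k"] unit[of k]
            ring_hom_add[OF rh(1)] ring_hom_add[OF rh(2)]
          by (simp add: vect_add vect_closed)
      qed
      from this[of "r + s"] have "h' (vect r s (vec (r + s) (\<lambda>i. if i < r + s then v $ i else 0)))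
          = h'' (vect r s (vec (r + s) (\<lambda>i. if i < r + s then v $ i else 0)))" by simp
      moreover have "vec (r + s) (\<lambda>i. if i < r + s then v $ i else 0) = v" using v by (intro eq_vecI) auto
      ultimately show ?thesis by simp
    qed
    note agree = this
    show ?thesis
    proof (rule extensionalityI)
      show "h' \<in> extensional (carrier C)" "h'' \<in> extensional (carrier C)"
        using hh by (simp_all add: is_beta_def)
      show "h' x = h'' x" if "x \<in> carrier C" for x
        by (rule hom_unique[OF iso agree that])
    qed
  qed
  ultimately show ?thesis by blast
qed

end

lemma is_c_c_map: "is_c r s (c_map r s)"
  unfolding c_map_def by (rule theI'[OF ex1_is_c])

lemma is_beta_beta_map: "is_beta r s (beta_map r s)"
  unfolding beta_map_def by (rule theI'[OF ex1_is_beta])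

end

theory Submission
  imports Defs
begin

text \<open>The involution \<beta> is an algebra automorphism, so it preserves commutators, and the
  sign of a bracket under \<beta> is the product of the signs of its arguments: this is the usual
  Z/2-grading of a Lie algebra by an involution. It remains to see that brackets stay inside
  \<open>\<GG>\<close>. An anti-automorphism swaps the two terms of a commutator, so for x, y in
  \<open>\<GG>\<close> one gets c[x,y] = [c(y),c(x)] = [-y,-x] = [y,x] = -[x,y]. These facts are
  \<open>beta_map_lie_bracket\<close> and \<open>\<GG>_lie_bracket\<close>. Since
  \<open>bracket_space\<close> is a linear span, the computation on single brackets suffices once
  \<open>\<KK>\<close> and \<open>\<PP>\<close> are known to be subspaces; both are intersections of
  eigenspaces of linear maps, which \<open>submodule_Cl_eigenspaces\<close> treats.\<close>

lemma (in abelian_group) additive_a_inv: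
  assumes closed: "\<And>x. x \<in> carrier G \<Longrightarrow> h x \<in> carrier G"
    and add: "\<And>x y. x \<in> carrier G \<Longrightarrow> y \<in> carrier G \<Longrightarrow> h (x \<oplus> y) = h x \<oplus> h y"
    and x: "x \<in> carrier G"
  shows "h (\<ominus> x) = \<ominus> h x"
proof -
  have "h \<zero> = \<zero>"
    using add[of \<zero> \<zero>] closed[of \<zero>] by (simp add: add.l_cancel_one')
  then have "h (\<ominus> x) \<oplus> h x = \<zero>"
    using add[of "\<ominus> x" x] x by (simp add: l_neg)
  then show ?thesis
    using x closed by (intro minus_equality[symmetric]) auto
qed

text \<open>Scalars act as left multiplication by classes of constants, so linearity questions in
  \<open>Cl r s\<close> reduce to its ring laws.\<close>

lemma Cl_smult: "a \<odot>\<^bsub>Cl r s\<^esub> x = clifford_class r s (Poly_Mapping.single 0 a) \<otimes>\<^bsub>Cl r s\<^esub> x"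
  by (simp add: C_simps)

lemma Cl_scalar_closed: "clifford_class r s (Poly_Mapping.single 0 a) \<in> carrier (Cl r s)"
  by (rule cls_closed[OF sc_carr])

lemma lie_bracket_closed:
  assumes "x \<in> carrier (Cl r s)" and "y \<in> carrier (Cl r s)"
  shows "lie_bracket r s x y \<in> carrier (Cl r s)"
proof -
  interpret ring "Cl r s" by (rule ring_C)
  show ?thesis using assms by (simp add: lie_bracket_def)
qed

lemma lie_bracket_anticomm:
  assumes "x \<in> carrier (Cl r s)" and "y \<in> carrier (Cl r s)"
  shows "lie_bracket r s y x = \<ominus>\<^bsub>Cl r s\<^esub> lie_bracket r s x y"
proof -
  interpret ring "Cl r s" by (rule ring_C)
  show ?thesis using assms by (simp add: lie_bracket_def minus_eq minus_add a_comm)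
qed

lemma lie_bracket_minus_right:
  assumes "x \<in> carrier (Cl r s)" and "y \<in> carrier (Cl r s)"
  shows "lie_bracket r s x (\<ominus>\<^bsub>Cl r s\<^esub> y) = \<ominus>\<^bsub>Cl r s\<^esub> lie_bracket r s x y"
proof -
  interpret ring "Cl r s" by (rule ring_C)
  show ?thesis using assms by (simp add: lie_bracket_def minus_eq minus_add l_minus r_minus)
qed

lemma lie_bracket_minus_minus:
  assumes "x \<in> carrier (Cl r s)" and "y \<in> carrier (Cl r s)"
  shows "lie_bracket r s (\<ominus>\<^bsub>Cl r s\<^esub> x) (\<ominus>\<^bsub>Cl r s\<^esub> y) = lie_bracket r s x y"
proof -
  interpret ring "Cl r s" by (rule ring_C)
  show ?thesis using assms by (simp add: lie_bracket_def l_minus r_minus)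
qed

text \<open>All four are read off from c being an isomorphism onto \<open>opposite (Cl r s)\<close>,
  which differs from \<open>Cl r s\<close> only in the order of products.\<close>

lemma
  fixes x y :: "'a::field clifford"
  shows c_map_closed: "x \<in> carrier (Cl r s) \<Longrightarrow> c_map r s x \<in> carrier (Cl r s)"
    and c_map_add: "x \<in> carrier (Cl r s) \<Longrightarrow> y \<in> carrier (Cl r s) \<Longrightarrow>
      c_map r s (x \<oplus>\<^bsub>Cl r s\<^esub> y) = c_map r s x \<oplus>\<^bsub>Cl r s\<^esub> c_map r s y"
    and c_map_mult: "x \<in> carrier (Cl r s) \<Longrightarrow> y \<in> carrier (Cl r s) \<Longrightarrow>
      c_map r s (x \<otimes>\<^bsub>Cl r s\<^esub> y) = c_map r s y \<otimes>\<^bsub>Cl r s\<^esub> c_map r s x"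
    and c_map_smult: "x \<in> carrier (Cl r s) \<Longrightarrow> c_map r s (a \<odot>\<^bsub>Cl r s\<^esub> x) = a \<odot>\<^bsub>Cl r s\<^esub> c_map r s x"
  using is_c_c_map[of r s, where 'a = 'a]
  by (simp_all add: Pi_iff is_c_def algebra_iso_def ring_iso_def ring_hom_def opposite_def)

lemma
  fixes x y :: "'a::field clifford"
  shows beta_map_closed: "x \<in> carrier (Cl r s) \<Longrightarrow> beta_map r s x \<in> carrier (Cl r s)"
    and beta_map_add: "x \<in> carrier (Cl r s) \<Longrightarrow> y \<in> carrier (Cl r s) \<Longrightarrow>
      beta_map r s (x \<oplus>\<^bsub>Cl r s\<^esub> y) = beta_map r s x \<oplus>\<^bsub>Cl r s\<^esub> beta_map r s y"
    and beta_map_mult: "x \<in> carrier (Cl r s) \<Longrightarrow> y \<in> carrier (Cl r s) \<Longrightarrow>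
      beta_map r s (x \<otimes>\<^bsub>Cl r s\<^esub> y) = beta_map r s x \<otimes>\<^bsub>Cl r s\<^esub> beta_map r s y"
    and beta_map_smult: "x \<in> carrier (Cl r s) \<Longrightarrow>
      beta_map r s (a \<odot>\<^bsub>Cl r s\<^esub> x) = a \<odot>\<^bsub>Cl r s\<^esub> beta_map r s x"
  using is_beta_beta_map[of r s, where 'a = 'a]
  by (simp_all add: Pi_iff is_beta_def algebra_iso_def ring_iso_def ring_hom_def)

lemma c_map_a_inv:
  "x \<in> carrier (Cl r s) \<Longrightarrow> c_map r s (\<ominus>\<^bsub>Cl r s\<^esub> x) = \<ominus>\<^bsub>Cl r s\<^esub> c_map r s x"
  by (rule abelian_group.additive_a_inv[OF ring.is_abelian_group[OF ring_C] c_map_closed c_map_add])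

lemma beta_map_a_inv:
  "x \<in> carrier (Cl r s) \<Longrightarrow> beta_map r s (\<ominus>\<^bsub>Cl r s\<^esub> x) = \<ominus>\<^bsub>Cl r s\<^esub> beta_map r s x"
  by (rule abelian_group.additive_a_inv[OF ring.is_abelian_group[OF ring_C] beta_map_closed beta_map_add])

text \<open>Reversing both products in xy - yx exchanges the roles of the two arguments.\<close>

lemma c_map_lie_bracket:
  assumes "x \<in> carrier (Cl r s)" and "y \<in> carrier (Cl r s)"
  shows "c_map r s (lie_bracket r s x y) = lie_bracket r s (c_map r s y) (c_map r s x)"
proof -
  interpret ring "Cl r s" by (rule ring_C)
  show ?thesis using assms
    by (simp add: lie_bracket_def minus_eq c_map_add c_map_mult c_map_a_inv)
qed

lemma beta_map_lie_bracket:
  assumes "x \<in> carrier (Cl r s)" and "y \<in> carrier (Cl r s)"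
  shows "beta_map r s (lie_bracket r s x y) = lie_bracket r s (beta_map r s x) (beta_map r s y)"
proof -
  interpret ring "Cl r s" by (rule ring_C)
  show ?thesis using assms
    by (simp add: lie_bracket_def minus_eq beta_map_add beta_map_mult beta_map_a_inv)
qed

text \<open>The two signs from c(x) = -x and c(y) = -y cancel; the one that survives comes from the
  exchange of the arguments.\<close>

lemma \<GG>_lie_bracket:
  assumes "x \<in> \<GG> r s" and "y \<in> \<GG> r s"
  shows "lie_bracket r s x y \<in> \<GG> r s"
  using assms
  \<comment> \<open>Fixing \<open>x\<close> orients anticommutativity: only brackets with
    \<open>x\<close> on the right are rewritten, which avoids a loop.\<close>
  by (simp add: \<GG>_def lie_bracket_closed c_map_lie_bracket lie_bracket_minus_minus
      lie_bracket_anticomm[of x])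

text \<open>Only linearity of \<open>h\<close> is assumed, not its behaviour on products, so that
  the automorphism \<beta> and the anti-automorphism c are both covered.\<close>

lemma submodule_Cl_eigenspaces:
  fixes h :: "'a::field clifford \<Rightarrow> 'a clifford"
  assumes closed: "\<And>x. x \<in> carrier (Cl r s) \<Longrightarrow> h x \<in> carrier (Cl r s)"
    and add: "\<And>x y. x \<in> carrier (Cl r s) \<Longrightarrow> y \<in> carrier (Cl r s) \<Longrightarrow>
      h (x \<oplus>\<^bsub>Cl r s\<^esub> y) = h x \<oplus>\<^bsub>Cl r s\<^esub> h y"
    and smult: "\<And>a x. x \<in> carrier (Cl r s) \<Longrightarrow> h (a \<odot>\<^bsub>Cl r s\<^esub> x) = a \<odot>\<^bsub>Cl r s\<^esub> h x"
  shows "submodule {x \<in> carrier (Cl r s). h x = x} scalars (Cl r s)"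
    and "submodule {x \<in> carrier (Cl r s). h x = \<ominus>\<^bsub>Cl r s\<^esub> x} scalars (Cl r s)"
proof -
  interpret ring "Cl r s" by (rule ring_C)
  note neg = additive_a_inv[OF closed add]
  have zero: "h \<zero>\<^bsub>Cl r s\<^esub> = \<zero>\<^bsub>Cl r s\<^esub>"
    using add[of "\<zero>\<^bsub>Cl r s\<^esub>" "\<zero>\<^bsub>Cl r s\<^esub>"] closed by (simp add: add.l_cancel_one')
  \<comment> \<open>The second equation is what makes the -1 eigenspace stable under scalars: h(ax)
    = a h(x) = a(-x) = -(ax).\<close>
  have scl: "a \<odot>\<^bsub>Cl r s\<^esub> x \<in> carrier (Cl r s)"
    "a \<odot>\<^bsub>Cl r s\<^esub> (\<ominus>\<^bsub>Cl r s\<^esub> x) = \<ominus>\<^bsub>Cl r s\<^esub> (a \<odot>\<^bsub>Cl r s\<^esub> x)"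
    if "x \<in> carrier (Cl r s)" for a x
    using that by (simp_all add: Cl_smult Cl_scalar_closed r_minus)
  show "submodule {x \<in> carrier (Cl r s). h x = x} scalars (Cl r s)"
    unfolding submodule_def submodule_axioms_def
    by (intro conjI add.subgroupI)
      \<comment> \<open>Folding \<open>a_inv_def\<close> turns inverses in the additive group into
        ring negation; zero witnesses nonemptiness.\<close>
      (auto simp: a_inv_def[symmetric] neg add smult scl intro!: exI[of _ "\<zero>\<^bsub>Cl r s\<^esub>"] zero)
  show "submodule {x \<in> carrier (Cl r s). h x = \<ominus>\<^bsub>Cl r s\<^esub> x} scalars (Cl r s)"
    unfolding submodule_def submodule_axioms_def
    by (intro conjI add.subgroupI)
      (auto simp: a_inv_def[symmetric] neg add smult scl minus_add zero
        intro!: exI[of _ "\<zero>\<^bsub>Cl r s\<^esub>"])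
qed

lemma submodule_Cl_Int:
  assumes "submodule U scalars (Cl r s)" and "submodule W scalars (Cl r s)"
  shows "submodule (U \<inter> W) scalars (Cl r s)"
proof -
  interpret ring "Cl r s" by (rule ring_C)
  show ?thesis
    using assms add.subgroups_Inter_pair[of U W]
    by (auto simp: submodule_def submodule_axioms_def)
qed

lemma submodule_\<GG>: "submodule (\<GG> r s) scalars (Cl r s)"
  unfolding \<GG>_def
  by (rule submodule_Cl_eigenspaces(2)) (auto simp: c_map_closed c_map_add c_map_smult)

lemma submodule_\<KK>: "submodule (\<KK> r s :: 'a::field clifford set) scalars (Cl r s)"
proof -
  \<comment> \<open>The eigenspace of \<beta> is taken in the whole algebra, where \<beta> is known
    to be linear, and then cut down to \<open>\<GG>\<close>.\<close>
  have "(\<KK> r s :: 'a clifford set) = \<GG> r s \<inter> {x \<in> carrier (Cl r s). beta_map r s x = x}"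
    by (auto simp: \<KK>_def \<GG>_def)
  then show ?thesis
    by (auto intro!: submodule_Cl_Int submodule_\<GG> submodule_Cl_eigenspaces(1)
        simp: beta_map_closed beta_map_add beta_map_smult)
qed

lemma submodule_\<PP>: "submodule (\<PP> r s :: 'a::field clifford set) scalars (Cl r s)"
proof -
  have "(\<PP> r s :: 'a clifford set) = \<GG> r s \<inter> {x \<in> carrier (Cl r s). beta_map r s x = \<ominus>\<^bsub>Cl r s\<^esub> x}"
    by (auto simp: \<PP>_def \<GG>_def)
  then show ?thesis
    by (auto intro!: submodule_Cl_Int submodule_\<GG> submodule_Cl_eigenspaces(2)
        simp: beta_map_closed beta_map_add beta_map_smult)
qed

text \<open>\<open>W\<close> is itself one of the subspaces whose intersection defines the
  span.\<close>

lemma bracket_space_subset: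
  assumes "submodule W scalars (Cl r s)"
    and "\<And>x y. x \<in> U \<Longrightarrow> y \<in> V \<Longrightarrow> lie_bracket r s x y \<in> W"
  shows "bracket_space r s U V \<subseteq> W"
  using assms by (auto simp: bracket_space_def)

theorem proposition2p4:
  fixes r s :: nat
  assumes "CHAR('a::field) \<noteq> 2" and "r \<ge> 0" and "s > 0"
  shows "bracket_space r s (\<KK> r s) (\<KK> r s) \<subseteq> (\<KK> r s :: 'a clifford set)
    \<and> bracket_space r s (\<KK> r s) (\<PP> r s) \<subseteq> (\<PP> r s :: 'a clifford set)
    \<and> bracket_space r s (\<PP> r s) (\<PP> r s) \<subseteq> (\<KK> r s :: 'a clifford set)"
proof -
  have carr: "x \<in> carrier (Cl r s)" if "x \<in> \<GG> r s" for x :: "'a clifford"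
    using that by (simp add: \<GG>_def)
  show ?thesis
  proof (intro conjI bracket_space_subset submodule_\<KK> submodule_\<PP>)
    \<comment> \<open>What is left is the sign of \<beta>[x,y] = [\<beta>(x),\<beta>(y)], which is
      [x,y], [x,-y] = -[x,y] and [-x,-y] = [x,y] in the three cases.\<close>
    fix x y :: "'a clifford"
    show "lie_bracket r s x y \<in> \<KK> r s" if "x \<in> \<KK> r s" "y \<in> \<KK> r s"
      using that by (simp add: \<KK>_def \<GG>_lie_bracket beta_map_lie_bracket carr)
    show "lie_bracket r s x y \<in> \<PP> r s" if "x \<in> \<KK> r s" "y \<in> \<PP> r s"
      using that
      by (simp add: \<KK>_def \<PP>_def \<GG>_lie_bracket beta_map_lie_bracket lie_bracket_minus_right carr)
    show "lie_bracket r s x y \<in> \<KK> r s" if "x \<in> \<PP> r s" "y \<in> \<PP> r s"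
      using that
      by (simp add: \<KK>_def \<PP>_def \<GG>_lie_bracket beta_map_lie_bracket lie_bracket_minus_minus carr)
  qed
qed

end
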